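(* Let $d\ge2$ and $N>1$ be integers, let $M\in\{d-1,d\}$, and let $S_{\mathbf a,\mathbf b}\subset\mathbb R^d$ be the two-row Hermite normal form simplex associated with $\mathbf a=(1,\ldots,1,N)$ and $\mathbf b=(M-1,\ldots,M-1,M,0)$. Then $$h^\ast_{S_{\mathbf a,\mathbf b}}(t)=\begin{cases}1+N\displaystyle\sum_{j=1}^{d-2}t^j+(N-1)t^{d-1},&\text{if }M=d-1,\\ 1+N\displaystyle\sum_{j=1}^{d-1}t^j+(N-1)t^{d},&\text{if }M=d.\end{cases}$$
   Context: For $\mathbf b=(b_1,\ldots,b_{d-2},M,0)$ and $\mathbf a=(a_1,\ldots,a_{d-1},N)$ in $\mathbb Z^d$, the two-row Hermite normal form simplex $S_{\mathbf a,\mathbf b}$ is the convex hull in $\mathbb R^d$ of $\mathbf v_0=\mathbf 0$, $\mathbf v_i=\mathbf e_i$ (standard unit vectors) for $1\le i\le d-2$, $\mathbf v_{d-1}=\mathbf b$, and $\mathbf v_d=\mathbf a$. In $\mathbf b=(M-1,\ldots,M-1,M,0)$ the first $d-2$ entries equal $M-1$; in $\mathbf a=(1,\ldots,1,N)$ the first $d-1$ entries equal $1$. For a $d$-dimensional lattice polytope $P\subset\mathbb R^d$, the $h^\ast$-polynomial $h^\ast_P(t)$ is the polynomial of degree at most $d$ defined by $\sum_{m\ge0}|mP\cap\mathbb Z^d|\,t^m=h^\ast_P(t)/(1-t)^{d+1}$. *)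

theory Defs
  imports "HOL-Analysis.Analysis" "HOL-Computational_Algebra.Polynomial_FPS"
begin

text \<open>The integer points of the d-dimensional space, where d is the cardinality of the index type.\<close>

definition int_lattice :: "(real ^ 'n::finite) set" where
  "int_lattice = {x. \<forall>i. x $ i \<in> \<int>}"

definition ehrhart_count :: "(real ^ 'n::finite) set \<Rightarrow> nat \<Rightarrow> nat" where
  "ehrhart_count P m = card ((\<lambda>x. real m *\<^sub>R x) ` P \<inter> int_lattice)"

text \<open>Meaningful for full-dimensional lattice polytopes. At most one polynomial satisfies the
  defining identity; that one exists is Ehrhart's theorem.\<close>

definition hstar_poly :: "(real ^ 'n::finite) set \<Rightarrow> real poly" where
  "hstar_poly P = (THE h. degree h \<le> CARD('n) \<and>
     Abs_fps (\<lambda>m. real (ehrhart_count P m)) = fps_of_poly h / (1 - fps_X) ^ (CARD('n) + 1))"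

text \<open>The index type carries no order, so a numbering pos of the coordinates by 0, ..., d - 1 is a
  parameter; the coordinate numbered k holds the (k+1)-st entry of a tuple.\<close>

definition lattice_vec :: "('n::finite \<Rightarrow> nat) \<Rightarrow> int list \<Rightarrow> real ^ 'n" where
  "lattice_vec pos xs = (\<chi> i. of_int (xs ! pos i))"

text \<open>The tuples a and b are meant to have length d and the shapes a = (a1, ..., N) and
  b = (b1, ..., M, 0).\<close>

definition two_row_hnf_simplex :: "('n::finite \<Rightarrow> nat) \<Rightarrow> int list \<Rightarrow> int list \<Rightarrow> (real ^ 'n) set" where
  "two_row_hnf_simplex pos a b =
     convex hull ({0} \<union> {axis i 1 |i. pos i < CARD('n) - 2} \<union> {lattice_vec pos b, lattice_vec pos a})"

end

theory Submission
  imports Defs "HOL-Library.Multiset"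
begin

text \<open>Let v_1, ..., v_d be linearly independent integer vectors. The lattice points of the cone
  they span are the lattice points of the half-open fundamental parallelepiped translated by the
  monoid they generate, so the h*-polynomial of the simplex with vertices 0, v_1, ..., v_d is
  the sum of t^h over the lattice points of the parallelepiped, where h is the sum of the coefficients with respect to v_1, ..., v_d, rounded up. For the present simplex these points
  are indexed by r = 0, ..., N M - 1: point r has coefficient r/(N M) at each of v_1, ..., v_(d-1),
  and \<open>\<lceil>r/N\<rceil> - r/N\<close> at v_d. The coefficients add up to \<open>\<lceil>r/N\<rceil>\<close> if M = d - 1 and to
  \<open>\<lceil>r/N\<rceil> - r/(N M)\<close> if M = d, so h = \<open>\<lceil>r/N\<rceil>\<close> in both cases. This number is 0 once, takes each value
  1, ..., M - 1 exactly N times, and is M exactly N - 1 times.\<close>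

section \<open>Simplices as linear images of the standard simplex\<close>

text \<open>The linear map sending each unit vector to \<open>V i\<close> carries the standard
  simplex, known from \<open>std_simplex\<close>, to this hull, because linear maps commute with
  convex hulls. Lattice points can then be counted through their coefficient vectors.\<close>

lemma convex_hull_insert_0_range:
  fixes V :: "'n::finite \<Rightarrow> real ^ 'n"
  shows "convex hull (insert 0 (range V)) =
    (\<lambda>l. \<Sum>i\<in>UNIV. l $ i *\<^sub>R V i) ` {l. (\<forall>i. 0 \<le> l $ i) \<and> (\<Sum>i\<in>UNIV. l $ i) \<le> 1}"
proof -
  define T :: "real ^ 'n \<Rightarrow> real ^ 'n" where "T = (\<lambda>l. \<Sum>i\<in>UNIV. l $ i *\<^sub>R V i)"
  have T: "linear T"
    unfolding T_def by (rule linearI) (simp_all add: scaleR_left_distrib sum.distrib scaleR_sum_right)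
  have Basis: "(Basis :: (real ^ 'n) set) = range (\<lambda>i. axis i 1)"
    by (auto simp: Basis_vec_def)
  have T_axis: "T (axis i 1) = V i" for i
    by (simp add: T_def axis_def if_distrib[of "\<lambda>c. c *\<^sub>R _"] cong: if_cong)
  have inj: "inj (\<lambda>i::'n. axis i (1::real))"
    by (auto simp: inj_def axis_eq_axis)
  have hull: "convex hull (insert 0 Basis) =
      {l :: real ^ 'n. (\<forall>i. 0 \<le> l $ i) \<and> (\<Sum>i\<in>UNIV. l $ i) \<le> 1}"
    unfolding std_simplex by (simp add: Basis sum.reindex[OF inj] inner_axis)
  have "insert 0 (range V) = T ` insert 0 Basis"
    using linear_0[OF T] by (simp add: Basis image_image T_axis)
  then show ?thesis
    unfolding T_def[symmetric] hull[symmetric] by (simp only: convex_hull_linear_image[OF T])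
qed

section \<open>Generating functions of bounded sums of natural numbers\<close>

lemma finite_nat_fun_sum_le: "finite {f :: 'n::finite \<Rightarrow> nat. (\<Sum>i\<in>UNIV. f i) + c \<le> m}"
proof (rule finite_subset)
  show "{f :: 'n \<Rightarrow> nat. (\<Sum>i\<in>UNIV. f i) + c \<le> m} \<subseteq> (\<Pi>\<^sub>E i\<in>UNIV. {..m})"
  proof (clarsimp simp: PiE_def)
    fix f :: "'n \<Rightarrow> nat" and i assume "(\<Sum>i\<in>UNIV. f i) + c \<le> m"
    moreover have "f i \<le> (\<Sum>i\<in>UNIV. f i)" by (rule member_le_sum) auto
    ultimately show "f i \<le> m" by simp
  qed
qed (auto intro: finite_PiE)

text \<open>Such functions correspond to multisets of size n over the type with one extra element,
  whose multiplicity takes up the slack.\<close>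

lemma card_nat_fun_sum_le:
  "card {f :: 'n::finite \<Rightarrow> nat. (\<Sum>i\<in>UNIV. f i) \<le> n} = (CARD('n) + n) choose n"
proof -
  have sum_option: "(\<Sum>x\<in>UNIV. g x) = g None + (\<Sum>i\<in>UNIV. g (Some i))" for g :: "'n option \<Rightarrow> nat"
    unfolding UNIV_option_conv by (subst sum.insert) (auto simp: sum.reindex)
  have size: "size X = (\<Sum>x\<in>UNIV. count X x)" for X :: "'n option multiset"
    unfolding size_multiset_overloaded_eq by (rule sum.mono_neutral_left) (auto simp: not_in_iff)
  have "bij_betw (\<lambda>X i. count X (Some i)) (multisets_of_size (UNIV :: 'n option set) n)
      {f :: 'n \<Rightarrow> nat. (\<Sum>i\<in>UNIV. f i) \<le> n}"
  proof (rule bij_betwI[where g = "\<lambda>f. Abs_multiset (case_option (n - (\<Sum>i\<in>UNIV. f i)) f)"],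
      goal_cases)
    case 1
    then show ?case by (auto simp: multisets_of_size_def size sum_option)
  next
    case 2
    then show ?case by (auto simp: multisets_of_size_def size sum_option)
  next
    case (3 X)
    then show ?case
      by (auto simp: multisets_of_size_def size sum_option multiset_eq_iff split: option.split)
  next
    case (4 f)
    then show ?case by (simp add: fun_eq_iff)
  qed
  from bij_betw_same_card[OF this] show ?thesis
    by (simp add: card_multisets_of_size)
qed

text \<open>The shift delays the count by \<open>c\<close> steps, hence the factor
  \<open>fps_X ^ c\<close>; for \<open>c = 0\<close> the counts are the binomial coefficients in the
  expansion of the inverse power. A parallelepiped point of height \<open>c\<close> will contribute
  exactly this series.\<close>

lemma Abs_fps_card_nat_fun_sum_le:
  "Abs_fps (\<lambda>m. of_nat (card {f :: 'n::finite \<Rightarrow> nat. (\<Sum>i\<in>UNIV. f i) + c \<le> m})) =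
    (fps_X ^ c / (1 - fps_X) ^ (CARD('n) + 1) :: 'a::field_char_0 fps)"
proof -
  have "Abs_fps (\<lambda>m. of_nat (card {f :: 'n::finite \<Rightarrow> nat. (\<Sum>i\<in>UNIV. f i) + c \<le> m})) =
      fps_X ^ c * Abs_fps (\<lambda>k. of_nat ((CARD('n) + k) choose k) :: 'a)"
  proof (rule fps_ext)
    fix m
    show "fps_nth (Abs_fps (\<lambda>m. of_nat (card {f :: 'n \<Rightarrow> nat. (\<Sum>i\<in>UNIV. f i) + c \<le> m}))) m =
        fps_nth (fps_X ^ c * Abs_fps (\<lambda>k. of_nat ((CARD('n) + k) choose k) :: 'a)) m"
    proof (cases "m < c")
      case False
      then have "(s + c \<le> m) = (s \<le> m - c)" for s by auto
      with False show ?thesis by (simp add: fps_X_power_mult_nth card_nat_fun_sum_le)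
    qed (simp add: fps_X_power_mult_nth)
  qed
  also have "Abs_fps (\<lambda>k. of_nat ((CARD('n) + k) choose k) :: 'a) =
      inverse ((1 - fps_X) ^ (CARD('n) + 1))"
    using one_minus_const_fps_X_neg_power'[of "CARD('n) + 1" "1::'a"] by simp
  finally show ?thesis by (simp add: fps_divide_unit)
qed

section \<open>The h*-polynomial of a simplex from its fundamental parallelepiped\<close>

text \<open>The vectors \<open>\<rho> r\<close> are the coefficient vectors of the lattice points of the half-open
  fundamental parallelepiped.\<close>

lemma ehrhart_count_simplex:
  fixes V :: "'n::finite \<Rightarrow> real ^ 'n" and \<rho> :: "'r \<Rightarrow> real ^ 'n"
  assumes inj: "inj (\<lambda>l :: real ^ 'n. \<Sum>i\<in>UNIV. l $ i *\<^sub>R V i)"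
    and "finite R" and inj_\<rho>: "inj_on \<rho> R"
    and \<rho>: "\<And>r i. r \<in> R \<Longrightarrow> 0 \<le> \<rho> r $ i \<and> \<rho> r $ i < 1"
    and lattice: "\<And>l :: real ^ 'n. (\<Sum>i\<in>UNIV. l $ i *\<^sub>R V i) \<in> int_lattice \<longleftrightarrow>
      (\<exists>r\<in>R. \<forall>i. l $ i - \<rho> r $ i \<in> \<int>)"
  shows "ehrhart_count (convex hull (insert 0 (range V))) m =
    (\<Sum>r\<in>R. card {f :: 'n \<Rightarrow> nat. (\<Sum>i\<in>UNIV. f i) + nat \<lceil>\<Sum>i\<in>UNIV. \<rho> r $ i\<rceil> \<le> m})"
proof -
  define T where "T = (\<lambda>l :: real ^ 'n. \<Sum>i\<in>UNIV. l $ i *\<^sub>R V i)"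
  \<comment> \<open>\<open>F r\<close> collects the translations of point \<open>r\<close> that stay
    in the dilate, \<open>L\<close> joins integer and fractional parts into a coefficient vector,
    and \<open>Q\<close> is the dilated coefficient simplex. The counting bijection is
    \<open>T \<circ> L\<close>.\<close>
  define F where "F = (\<lambda>r. {f :: 'n \<Rightarrow> nat. (\<Sum>i\<in>UNIV. f i) + nat \<lceil>\<Sum>i\<in>UNIV. \<rho> r $ i\<rceil> \<le> m})"
  define L where "L = (\<lambda>(r, f). (\<chi> i. real (f i) + \<rho> r $ i))"
  define Q where "Q = {l :: real ^ 'n. (\<forall>i. 0 \<le> l $ i) \<and> (\<Sum>i\<in>UNIV. l $ i) \<le> real m}"
  have scaled: "(\<lambda>x. real m *\<^sub>R x) ` (convex hull (insert 0 (range V))) = T ` Q"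
  proof -
    have "T (real m *\<^sub>R l) = real m *\<^sub>R T l" for l
      by (simp add: T_def scaleR_sum_right)
    moreover have "(\<lambda>l. real m *\<^sub>R l) ` {l :: real ^ 'n. (\<forall>i. 0 \<le> l $ i) \<and> (\<Sum>i\<in>UNIV. l $ i) \<le> 1} = Q" (is "?scale = Q")
    \<comment> \<open>Rescaling by \<open>1 / real m\<close> fails for \<open>m = 0\<close>, where
      nonnegativity and the sum bound leave only the origin.\<close>
    proof (cases "m = 0")
      case True
      have "Q = {0}"
      proof -
        have "l = 0" if "l \<in> Q" for l
        proof -
          have "(\<Sum>i\<in>UNIV. l $ i) = 0"
            using that True by (auto simp: Q_def intro: antisym sum_nonneg)
          then show ?thesis
            using that by (auto simp: Q_def vec_eq_iff sum_nonneg_eq_0_iff)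
        qed
        moreover have "0 \<in> Q" by (simp add: Q_def)
        ultimately show ?thesis by auto
      qed
      with True show ?thesis by (auto intro: image_eqI[where x = 0])
    next
      case False
      show ?thesis
      proof (intro equalityI subsetI)
        fix l assume "l \<in> Q"
        with False show "l \<in> (\<lambda>l. real m *\<^sub>R l) ` {l :: real ^ 'n. (\<forall>i. 0 \<le> l $ i) \<and> (\<Sum>i\<in>UNIV. l $ i) \<le> 1}"
          by (intro image_eqI[where x = "(1 / real m) *\<^sub>R l"])
            (auto simp: Q_def simp flip: sum_divide_distrib)
      qed (use False in \<open>auto simp: Q_def mult_le_cancel_left1 simp flip: sum_distrib_left\<close>)
    qed
    then have "Q = ?scale" ..
    ultimately show ?thesis
      unfolding convex_hull_insert_0_range T_def[symmetric] by (simp add: image_image)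
  qed
  have sum_L: "(\<Sum>i\<in>UNIV. L (r, f) $ i) = real (\<Sum>i\<in>UNIV. f i) + (\<Sum>i\<in>UNIV. \<rho> r $ i)" for r f
    by (simp add: L_def sum.distrib)
  \<comment> \<open>The sum of \<open>f\<close> is an integer, so the bound on the total survives
    rounding up the sum of \<open>\<rho> r\<close>; that sum is nonnegative, so \<open>nat\<close>
    changes nothing.\<close>
  have le_m: "(\<Sum>i\<in>UNIV. L (r, f) $ i) \<le> real m \<longleftrightarrow> f \<in> F r" if "r \<in> R" for r f
  proof -
    have "0 \<le> (\<Sum>i\<in>UNIV. \<rho> r $ i)" using \<rho>[OF that] by (simp add: sum_nonneg)
    then have "f \<in> F r \<longleftrightarrow> \<lceil>\<Sum>i\<in>UNIV. \<rho> r $ i\<rceil> \<le> int m - int (\<Sum>i\<in>UNIV. f i)"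
      unfolding F_def mem_Collect_eq by linarith
    also have "\<dots> \<longleftrightarrow> (\<Sum>i\<in>UNIV. \<rho> r $ i) \<le> real m - real (\<Sum>i\<in>UNIV. f i)"
      by (simp add: ceiling_le_iff)
    finally show ?thesis unfolding sum_L by linarith
  qed
  have "bij_betw (T \<circ> L) (Sigma R F) (T ` Q \<inter> int_lattice)"
  proof (rule bij_betw_imageI)
    \<comment> \<open>Entries of \<open>\<rho> r\<close> lie in [0,1), so an entry of
      \<open>L (r, f)\<close> determines its integer and fractional parts.\<close>
    have "inj_on L (Sigma R F)"
    proof (rule inj_onI, clarify)
      fix r f s g assume rs: "r \<in> R" "s \<in> R" and eq: "L (r, f) = L (s, g)"
      have fg: "f i = g i" "\<rho> r $ i = \<rho> s $ i" for i
      proof -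
        have "real (f i) + \<rho> r $ i = real (g i) + \<rho> s $ i"
          using eq by (simp add: L_def vec_eq_iff)
        moreover from this show "f i = g i"
          using \<rho>[OF rs(1), of i] \<rho>[OF rs(2), of i] by linarith
        ultimately show "\<rho> r $ i = \<rho> s $ i" by simp
      qed
      then have "\<rho> r = \<rho> s" by (simp add: vec_eq_iff)
      with inj_\<rho> rs have "r = s" by (auto dest: inj_onD)
      with fg show "r = s \<and> f = g" by auto
    qed
    then show "inj_on (T \<circ> L) (Sigma R F)"
      using inj unfolding T_def[symmetric] by (intro comp_inj_on) (auto intro: inj_on_subset)
  next
    have "T (L (r, f)) \<in> T ` Q \<inter> int_lattice" if "r \<in> R" "f \<in> F r" for r f
    proof -
      have "L (r, f) \<in> Q"
        using \<rho>[OF that(1)] le_m[OF that(1), of f] that(2) by (auto simp: Q_def L_def)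
      moreover have "T (L (r, f)) \<in> int_lattice"
        unfolding T_def lattice using that(1) by (intro bexI[of _ r]) (simp_all add: L_def)
      ultimately show ?thesis by auto
    qed
    moreover have "T l \<in> (T \<circ> L) ` Sigma R F" if "l \<in> Q" "T l \<in> int_lattice" for l
    proof -
      from that(2) obtain r where r: "r \<in> R" "\<And>i. l $ i - \<rho> r $ i \<in> \<int>"
        unfolding T_def lattice by auto
      \<comment> \<open>The difference is an integer, and \<open>0 \<le> l $ i\<close> with
        \<open>\<rho> r $ i < 1\<close> forces it above -1, so \<open>nat\<close> truncates
        nothing.\<close>
      define f where "f = (\<lambda>i. nat \<lfloor>l $ i - \<rho> r $ i\<rfloor>)"
      have "real (f i) = l $ i - \<rho> r $ i" for i
      proof -
        from r(2) obtain k where k: "l $ i - \<rho> r $ i = of_int k" by (metis Ints_cases)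
        have "0 \<le> l $ i" using that(1) by (simp add: Q_def)
        with k \<rho>[OF r(1), of i] have "k > -1" by linarith
        with k show ?thesis by (simp add: f_def)
      qed
      then have l: "l = L (r, f)" by (simp add: L_def vec_eq_iff)
      with that(1) le_m[OF r(1), of f] have "f \<in> F r" by (simp add: Q_def)
      with r(1) l show ?thesis by auto
    qed
    ultimately show "(T \<circ> L) ` Sigma R F = T ` Q \<inter> int_lattice" by fastforce
  qed
  then have "ehrhart_count (convex hull (insert 0 (range V))) m = card (Sigma R F)"
    unfolding ehrhart_count_def scaled by (simp add: bij_betw_same_card)
  also have "\<dots> = (\<Sum>r\<in>R. card (F r))"
    using \<open>finite R\<close> by (intro card_SigmaI) (auto simp: F_def intro: finite_nat_fun_sum_le)
  finally show ?thesis by (simp add: F_def)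
qed

text \<open>As \<open>hstar_poly\<close> is a definite description, uniqueness is the issue: the
  denominator has nonzero constant coefficient, so it is invertible and cancels, and
  \<open>fps_of_poly\<close> is injective.\<close>

lemma hstar_poly_eqI:
  fixes P :: "(real ^ 'n::finite) set"
  assumes "degree h \<le> CARD('n)"
    and "Abs_fps (\<lambda>m. real (ehrhart_count P m)) = fps_of_poly h / (1 - fps_X) ^ (CARD('n) + 1)"
  shows "hstar_poly P = h"
  unfolding hstar_poly_def
proof (rule the_equality)
  fix g assume g: "degree g \<le> CARD('n) \<and>
    Abs_fps (\<lambda>m. real (ehrhart_count P m)) = fps_of_poly g / (1 - fps_X) ^ (CARD('n) + 1)"
  define u :: "real fps" where "u = (1 - fps_X) ^ (CARD('n) + 1)"
  have u0: "fps_nth u 0 \<noteq> 0" by (simp add: u_def fps_nth_power_0)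
  have "fps_of_poly g * inverse u = fps_of_poly h * inverse u"
    using g assms(2) u0 unfolding u_def[symmetric] by (simp add: fps_divide_unit)
  moreover have "inverse u \<noteq> 0" using u0 by (simp add: fps_inverse_eq_0_iff)
  ultimately show "g = h" by (simp add: fps_of_poly_eq_iff)
qed (use assms in simp)

theorem hstar_poly_simplex:
  fixes V :: "'n::finite \<Rightarrow> real ^ 'n" and \<rho> :: "'r \<Rightarrow> real ^ 'n"
  assumes inj: "inj (\<lambda>l :: real ^ 'n. \<Sum>i\<in>UNIV. l $ i *\<^sub>R V i)"
    and "finite R" and inj_\<rho>: "inj_on \<rho> R"
    and \<rho>: "\<And>r i. r \<in> R \<Longrightarrow> 0 \<le> \<rho> r $ i \<and> \<rho> r $ i < 1"
    and lattice: "\<And>l :: real ^ 'n. (\<Sum>i\<in>UNIV. l $ i *\<^sub>R V i) \<in> int_lattice \<longleftrightarrow>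
      (\<exists>r\<in>R. \<forall>i. l $ i - \<rho> r $ i \<in> \<int>)"
  shows "hstar_poly (convex hull (insert 0 (range V))) =
    (\<Sum>r\<in>R. monom 1 (nat \<lceil>\<Sum>i\<in>UNIV. \<rho> r $ i\<rceil>))"
proof (rule hstar_poly_eqI)
  have "nat \<lceil>\<Sum>i\<in>UNIV. \<rho> r $ i\<rceil> \<le> CARD('n)" if "r \<in> R" for r
  proof -
    have "(\<Sum>i\<in>UNIV. \<rho> r $ i) \<le> (\<Sum>i\<in>(UNIV :: 'n set). 1)"
      using \<rho>[OF that] by (intro sum_mono) (simp add: less_imp_le)
    then show ?thesis by (simp add: ceiling_le_iff nat_le_iff)
  qed
  then show "degree (\<Sum>r\<in>R. monom (1::real) (nat \<lceil>\<Sum>i\<in>UNIV. \<rho> r $ i\<rceil>)) \<le> CARD('n)"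
    using \<open>finite R\<close> by (intro degree_sum_le) (auto intro: order.trans[OF degree_monom_le])
next
  let ?c = "\<lambda>r. nat \<lceil>\<Sum>i\<in>UNIV. \<rho> r $ i\<rceil>"
  have "Abs_fps (\<lambda>m. real (ehrhart_count (convex hull (insert 0 (range V))) m)) =
      (\<Sum>r\<in>R. Abs_fps (\<lambda>m. real (card {f :: 'n \<Rightarrow> nat. (\<Sum>i\<in>UNIV. f i) + ?c r \<le> m})))"
    by (intro fps_ext) (simp add: ehrhart_count_simplex[OF assms] fps_sum_nth)
  also have "\<dots> = (\<Sum>r\<in>R. fps_X ^ ?c r * inverse ((1 - fps_X) ^ (CARD('n) + 1)))"
    by (simp only: Abs_fps_card_nat_fun_sum_le) (simp add: fps_divide_unit)
  also have "\<dots> = (\<Sum>r\<in>R. fps_X ^ ?c r) * inverse ((1 - fps_X) ^ (CARD('n) + 1))"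
    by (simp only: sum_distrib_right)
  also have "\<dots> = fps_of_poly (\<Sum>r\<in>R. monom 1 (?c r)) / (1 - fps_X) ^ (CARD('n) + 1)"
    by (simp add: fps_of_poly_sum fps_of_poly_monom' fps_divide_unit)
  finally show "Abs_fps (\<lambda>m. real (ehrhart_count (convex hull (insert 0 (range V))) m)) =
    fps_of_poly (\<Sum>r\<in>R. monom 1 (?c r)) / (1 - fps_X) ^ (CARD('n) + 1)" .
qed


section \<open>Heights and coefficients of the parallelepiped points\<close>

text \<open>For k > 0 the ceiling is k exactly when r runs through the N values (k-1)N + 1, ..., kN.
  So r = 0 stands alone, and the block of k = M lacks its last element r = NM, hence the coefficient
  N - 1.\<close>

lemma sum_monom_nat_ceiling_divide:
  fixes N M :: nat
  assumes "0 < N" "0 < M"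
  shows "(\<Sum>r<N * M. monom 1 (nat \<lceil>real r / real N\<rceil>)) =
    1 + smult (of_nat N) (\<Sum>j=1..M-1. monom 1 j) + monom (of_nat N - 1 :: 'a::comm_ring_1) M"
proof -
  obtain K where K: "M = Suc K" using assms(2) gr0_conv_Suc by blast
  define g where "g = (\<lambda>r. monom (1::'a) (nat \<lceil>real r / real N\<rceil>))"
  have "g (Suc r) = monom 1 (Suc m)" if "r \<in> {m * N..<m * N + N}" for r m
  proof -
    have "real m < real (Suc r) / real N" "real (Suc r) / real N \<le> real m + 1"
      using that assms(1) by (simp_all add: field_simps del: of_nat_Suc flip: of_nat_mult of_nat_add)
    then have "\<lceil>real (Suc r) / real N\<rceil> = int (Suc m)" by (simp add: ceiling_eq_iff)
    then show ?thesis by (simp add: g_def del: of_nat_Suc)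
  qed
  then have "(\<Sum>r\<in>{m * N..<m * N + N}. g (Suc r)) = smult (of_nat N) (monom 1 (Suc m))" for m
    by (simp add: of_nat_poly)
  then have "(\<Sum>r<M * N. g (Suc r)) = (\<Sum>m<M. smult (of_nat N) (monom 1 (Suc m)))"
    by (simp flip: sum.nat_group)
  also have "\<dots> = smult (of_nat N) (\<Sum>m<M. monom 1 (Suc m))"
    by (induction M) (simp_all add: smult_add_right)
  also have "\<dots> = smult (of_nat N) (\<Sum>j=1..K. monom 1 j) + monom (of_nat N) M"
    by (simp add: K sum.atLeast1_atMost_eq smult_add_right smult_monom)
  moreover have "(\<Sum>r<M * N. g r) + g (M * N) = g 0 + (\<Sum>r<M * N. g (Suc r))"
    by (metis sum.lessThan_Suc sum.lessThan_Suc_shift)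
  moreover have "g 0 = 1" "g (M * N) = monom 1 M"
    using assms by (simp_all add: g_def)
  ultimately show ?thesis
    by (simp add: g_def K mult.commute[of N] algebra_simps diff_monom[symmetric])
qed

text \<open>The left side will be the integrality of the coordinates of a combination of the
  vertices. Subtracting the condition at \<open>p\<close> from that at \<open>j\<close> makes
  \<open>l j - l p\<close> integral, so all coefficients except the one at \<open>q\<close> agree
  modulo 1. The number N M \<open>l p\<close> is an integer, its residue modulo N M is
  \<open>r\<close>, and the condition at \<open>p\<close> then fixes \<open>l q\<close> modulo
  1.\<close>

lemma int_coordinates_iff:
  fixes p q :: 'i and N M :: nat and l :: "'i \<Rightarrow> real"
  assumes pq: "p \<noteq> q" and N: "0 < N" and M: "0 < M"
  shows "real N * l q \<in> \<int> \<and> real M * l p + l q \<in> \<int> \<and>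
      (\<forall>j. j \<noteq> p \<longrightarrow> j \<noteq> q \<longrightarrow> l j + (real M - 1) * l p + l q \<in> \<int>) \<longleftrightarrow>
    (\<exists>r\<in>{..<N * M}. \<forall>i. l i - (if i = q then of_int \<lceil>real r / real N\<rceil> - real r / real N
      else real r / real (N * M)) \<in> \<int>)"
  (is "?int \<longleftrightarrow> (\<exists>r\<in>_. \<forall>i. l i - ?\<rho> r i \<in> \<int>)")
proof
  assume int: ?int
  then obtain z x where z: "real N * l q = of_int z" and x: "real M * l p + l q = of_int x"
    by (auto elim!: Ints_cases)
  \<comment> \<open>\<open>t\<close> is N M \<open>l p\<close>, found by multiplying the condition
    at \<open>p\<close> by N and eliminating N \<open>l q\<close>. Its remainder names the
    parallelepiped point.\<close>
  define t where "t = int N * x - z"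
  define k where "k = t div int (N * M)"
  define r where "r = nat (t mod int (N * M))"
  have "int r = t mod int (N * M)" using N M by (simp add: r_def)
  then have t: "t = k * int (N * M) + int r" by (simp only: k_def div_mult_mod_eq)
  have r: "r < N * M" using N M by (simp add: r_def nat_less_iff)
  have "real N * real M * l p = real N * of_int x - of_int z"
    unfolding x[symmetric] z[symmetric] by (simp add: algebra_simps)
  also have "\<dots> = of_int t" by (simp add: t_def)
  finally have lp: "l p = of_int k + real r / real (N * M)"
    using N M by (simp add: t field_simps)
  have "real M * l p = real M * of_int k + real r / real N"
    using M by (simp add: lp distrib_left)
  \<comment> \<open>Modulo 1 this is -r/N; the ceiling in the representative at \<open>q\<close>
    moves it into [0,1).\<close>
  with x have lq: "l q = of_int (x - int M * k) - real r / real N" by simp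
  have "l i - ?\<rho> r i \<in> \<int>" for i
  proof -
    consider "i = q" | "i = p" | "i \<noteq> p" "i \<noteq> q" by blast
    then show ?thesis
    proof cases
      case 3
      have "l i - ?\<rho> r i = l i - l p + of_int k" using 3 lp by simp
      also have "\<dots> = (l i + (real M - 1) * l p + l q) - (real M * l p + l q) + of_int k"
        by (simp add: algebra_simps)
      also have "\<dots> \<in> \<int>" by (rule Ints_add[OF Ints_diff Ints_of_int]) (use int 3 in auto)
      finally show ?thesis .
    qed (use pq in \<open>simp_all add: lp lq\<close>)
  qed
  with r show "\<exists>r\<in>{..<N * M}. \<forall>i. l i - ?\<rho> r i \<in> \<int>" by (intro bexI allI) simp_all
next
  assume "\<exists>r\<in>{..<N * M}. \<forall>i. l i - ?\<rho> r i \<in> \<int>"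
  then obtain r where r: "\<And>i. l i - ?\<rho> r i \<in> \<int>" by blast
  obtain k where "l q - ?\<rho> r q = of_int k" using r[of q] by (auto elim!: Ints_cases)
  then have lq: "l q = of_int (k + \<lceil>real r / real N\<rceil>) - real r / real N" by simp
  obtain k' where k': "l p - ?\<rho> r p = of_int k'" using r[of p] by (auto elim!: Ints_cases)
  then have lp: "l p = of_int k' + real r / real (N * M)" using pq by simp
  have "real N * l q = of_int (int N * (k + \<lceil>real r / real N\<rceil>) - int r)"
    using N by (simp add: lq field_simps)
  then have 1: "real N * l q \<in> \<int>" by (metis Ints_of_int)
  have "real M * l p + l q = of_int (int M * k' + k + \<lceil>real r / real N\<rceil>)"
    using N M by (simp add: lq lp field_simps)
  then have 2: "real M * l p + l q \<in> \<int>" by (metis Ints_of_int)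
  have "l j + (real M - 1) * l p + l q \<in> \<int>" if "j \<noteq> p" "j \<noteq> q" for j
  proof -
    have "l j + (real M - 1) * l p + l q =
        (l j - ?\<rho> r j) - (l p - ?\<rho> r p) + (real M * l p + l q)"
      using that pq by (simp add: algebra_simps)
    also have "\<dots> \<in> \<int>" by (rule Ints_add[OF Ints_diff[OF r r] 2])
    finally show ?thesis .
  qed
  with 1 2 show ?int by blast
qed

section \<open>The h*-polynomial of the two-row simplex\<close>

theorem theorem5p10:
  fixes pos :: "'n::finite \<Rightarrow> nat" and d :: nat and N M :: int and a b :: "int list"
  assumes "d \<ge> 2" and "CARD('n) = d" and "bij_betw pos UNIV {..<d}"
    and "N > 1" and "M \<in> {int d - 1, int d}"
    and "a = replicate (d - 1) 1 @ [N]"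
    and "b = replicate (d - 2) (M - 1) @ [M, 0]"
  shows "hstar_poly (two_row_hnf_simplex pos a b) =
    (if M = int d - 1
     then 1 + smult (of_int N) (\<Sum>j=1..d-2. monom 1 j) + monom (of_int (N - 1)) (d - 1)
     else 1 + smult (of_int N) (\<Sum>j=1..d-1. monom 1 j) + monom (of_int (N - 1)) d)"
proof -
  define n m where "n = nat N" and "m = nat M"
  have n: "N = int n" "n > 0" using assms(4) by (auto simp: n_def)
  have m: "M = int m" "m > 0" "m = d - 1 \<or> m = d" using assms(1,5) by (auto simp: m_def)
  have inj_pos: "pos i = pos j \<longleftrightarrow> i = j" for i j
    using assms(3) by (auto simp: bij_betw_def dest: injD)
  have pos_range: "range pos = {..<d}" using assms(3) by (simp add: bij_betw_def)
  then have "d - 2 \<in> range pos" "d - 1 \<in> range pos" using assms(1) by auto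
  then obtain p q where p: "pos p = d - 2" and q: "pos q = d - 1" by (metis rangeE)
  have pq: "p \<noteq> q" using p q assms(1) by auto
  have rest: "pos i < d - 2 \<longleftrightarrow> i \<noteq> p \<and> i \<noteq> q" for i
  proof -
    have "pos i < d" using pos_range by auto
    then show ?thesis using p q inj_pos[of i p] inj_pos[of i q] by auto
  qed
  have a: "lattice_vec pos a $ j = (if j = q then real n else 1)" for j
    using rest[of j] p q assms(1) n
    by (cases "j = q"; cases "j = p") (auto simp: lattice_vec_def assms(6) nth_append)
  have b: "lattice_vec pos b $ j = (if j = q then 0 else if j = p then real m else real m - 1)" for j
    using rest[of j] p q assms(1) m
    by (cases "j = q"; cases "j = p") (auto simp: lattice_vec_def assms(7) nth_append nth_Cons')
  \<comment> \<open>Vertices are indexed by coordinates: b and a take the indices \<open>p\<close>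
    and \<open>q\<close> of the last two coordinates, whose unit vectors are absent from the vertex
    list.\<close>
  define V where "V = (\<lambda>i. if i = p then lattice_vec pos b else if i = q then lattice_vec pos a
    else axis i 1)"
  define T where "T = (\<lambda>l :: real ^ 'n. \<Sum>i\<in>UNIV. l $ i *\<^sub>R V i)"
  define \<rho> :: "nat \<Rightarrow> real ^ 'n" where
    "\<rho> = (\<lambda>r. \<chi> i. if i = q then of_int \<lceil>real r / real n\<rceil> - real r / real n
      else real r / real (n * m))"
  have UNIV: "(UNIV :: 'n set) = insert p (insert q (- {p, q}))" by auto
  have simplex: "two_row_hnf_simplex pos a b = convex hull (insert 0 (range V))"
  proof -
    have "V ` (- {p, q}) = (\<lambda>i. axis i 1) ` (- {p, q})"
      by (rule image_cong) (auto simp: V_def)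
    moreover have "range V = {V p, V q} \<union> V ` (- {p, q})"
      by (subst UNIV) auto
    ultimately have "insert 0 (range V) =
        {0} \<union> {axis i 1 |i. pos i < d - 2} \<union> {lattice_vec pos b, lattice_vec pos a}"
      using pq by (auto simp: V_def rest image_def)
    then show ?thesis by (simp add: two_row_hnf_simplex_def assms(2))
  qed
  have T: "T l $ j = (if j = q then real n * l $ q else if j = p then real m * l $ p + l $ q
      else l $ j + (real m - 1) * l $ p + l $ q)" for l j
  proof -
    have "T l $ j = (\<Sum>i\<in>UNIV. l $ i * V i $ j)" by (simp add: T_def)
    also have "\<dots> = l $ p * V p $ j + l $ q * V q $ j + (\<Sum>i\<in>- {p, q}. l $ i * V i $ j)"
      by (subst UNIV) (use pq in simp)
    also have "(\<Sum>i\<in>- {p, q}. l $ i * V i $ j) = (\<Sum>i\<in>- {p, q}. if i = j then l $ i else 0)"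
      by (rule sum.cong) (auto simp: V_def axis_def)
    finally show ?thesis using pq by (auto simp: V_def a b)
  qed
  have unit: "real r / real (n * m) < 1" if "r \<in> {..<n * m}" for r
    using that n m by (simp add: field_simps flip: of_nat_mult)
  \<comment> \<open>Back-substitution: coordinate \<open>q\<close> determines \<open>l $ q\<close>,
    then \<open>p\<close> determines \<open>l $ p\<close>, and these determine the rest.\<close>
  have "inj T"
  proof (rule injI)
    fix k l assume "T k = T l"
    then have eq: "T k $ j = T l $ j" for j by simp
    have "k $ q = l $ q" using eq[of q] n by (simp add: T)
    moreover from this have "k $ p = l $ p" using eq[of p] m pq by (simp add: T)
    ultimately have "k $ j = l $ j" for j using eq[of j] by (auto simp: T split: if_splits)
    then show "k = l" by (simp add: vec_eq_iff)
  qed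
  moreover have "T l \<in> int_lattice \<longleftrightarrow> (\<exists>r\<in>{..<n * m}. \<forall>i. l $ i - \<rho> r $ i \<in> \<int>)" for l
  proof -
    have "T l \<in> int_lattice \<longleftrightarrow> real n * l $ q \<in> \<int> \<and> real m * l $ p + l $ q \<in> \<int> \<and>
        (\<forall>j. j \<noteq> p \<longrightarrow> j \<noteq> q \<longrightarrow> l $ j + (real m - 1) * l $ p + l $ q \<in> \<int>)"
      using pq by (auto simp: int_lattice_def T)
    also have "\<dots> \<longleftrightarrow> (\<exists>r\<in>{..<n * m}. \<forall>i. l $ i - \<rho> r $ i \<in> \<int>)"
      using int_coordinates_iff[OF pq n(2) m(2), of "\<lambda>i. l $ i"] by (simp add: \<rho>_def)
    finally show ?thesis .
  qed
  moreover have "0 \<le> \<rho> r $ i \<and> \<rho> r $ i < 1" if "r \<in> {..<n * m}" for r i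
    using unit[OF that] ceiling_correct[of "real r / real n"] by (simp add: \<rho>_def)
  moreover have "inj_on \<rho> {..<n * m}"
  proof (rule inj_onI)
    fix r s assume "\<rho> r = \<rho> s"
    then have "\<rho> r $ p = \<rho> s $ p" by simp
    then show "r = s" using n m pq by (simp add: \<rho>_def)
  qed
  ultimately have "hstar_poly (two_row_hnf_simplex pos a b) =
      (\<Sum>r<n * m. monom 1 (nat \<lceil>\<Sum>i\<in>UNIV. \<rho> r $ i\<rceil>))"
    unfolding simplex T_def by (intro hstar_poly_simplex) auto
  also have "\<dots> = (\<Sum>r<n * m. monom 1 (nat \<lceil>real r / real n\<rceil>))"
  proof (rule sum.cong)
    fix r assume r: "r \<in> {..<n * m}"
    have card: "real (card (- {p, q})) = real d - 2"
      using assms(1) pq by (simp add: card_Diff_subset Compl_eq_Diff_UNIV assms(2) of_nat_diff)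
    have "(\<Sum>i\<in>UNIV. \<rho> r $ i) = \<rho> r $ p + \<rho> r $ q + (\<Sum>i\<in>- {p, q}. \<rho> r $ i)"
      by (subst UNIV) (use pq in simp)
    also have "(\<Sum>i\<in>- {p, q}. \<rho> r $ i) = (\<Sum>i\<in>- {p, q}. real r / real (n * m))"
      by (rule sum.cong) (auto simp: \<rho>_def)
    also have "\<dots> = (real d - 2) * (real r / real (n * m))"
      by (simp only: sum_constant card)
    \<comment> \<open>Since r/n is m copies of r/(nm), the d - 1 equal coefficients leave only m -
      (d - 1) copies to subtract.\<close>
    also have "\<rho> r $ p + \<rho> r $ q + \<dots> =
        of_int \<lceil>real r / real n\<rceil> - (real m - (real d - 1)) * (real r / real (n * m))"
      using pq n m by (simp add: \<rho>_def field_simps)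
    finally have "(\<Sum>i\<in>UNIV. \<rho> r $ i) =
        of_int \<lceil>real r / real n\<rceil> - (real m - (real d - 1)) * (real r / real (n * m))" .
    \<comment> \<open>Subtracting 0 or a number in [0,1) from an integer does not change its
      ceiling, so both values of M give the same formula for the height.\<close>
    moreover have "real m - (real d - 1) \<in> {0, 1}" using m(3) assms(1) by (auto simp: of_nat_diff)
    ultimately have "\<lceil>\<Sum>i\<in>UNIV. \<rho> r $ i\<rceil> = \<lceil>real r / real n\<rceil>"
      using unit[OF r] by (auto simp: ceiling_eq_iff)
    then show "monom 1 (nat \<lceil>\<Sum>i\<in>UNIV. \<rho> r $ i\<rceil>) = monom (1::real) (nat \<lceil>real r / real n\<rceil>)"
      by simp
  qed simp
  also have "\<dots> = 1 + smult (of_nat n) (\<Sum>j=1..m-1. monom 1 j) + monom (of_nat n - 1) m"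
    by (rule sum_monom_nat_ceiling_divide[OF n(2) m(2)])
  finally show ?thesis
    using m n assms(1) by (auto simp: numeral_2_eq_2 of_nat_diff)
qed

end
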